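(* Let $M$ be a smooth compact connected manifold and let $\delta$ be a linear endomorphism of the algebra $\wedge^*(M)$ of differential forms such that $\delta$ maps $\wedge^p(M)$ to $\wedge^{p+1}(M)$ for all $p$, $\delta(\alpha\wedge\beta)=\delta\alpha\wedge\beta+(-1)^{|\alpha|}\alpha\wedge\delta\beta$ for all homogeneous $\alpha$ and all $\beta$, and $\delta^2=0$. Suppose that - the $d\delta$-lemma holds, i.e. $(\ker d\cap\ker\delta)\cap(\operatorname{Im} d+\operatorname{Im}\delta)=\operatorname{Im} d\delta$; - $d\delta+\delta d=0$. Then $\ker\delta\cap\wedge^0(M)=\mathbb{R}$, the constant functions.
   Context: $\wedge^*(M)=\bigoplus_p\wedge^p(M)$ denotes the algebra of smooth real differential forms, $\wedge^0(M)=C^\infty(M,\mathbb{R})$, $|\alpha|$ is the degree of $\alpha$, and $d$ is the exterior derivative. Kernels and images are those of operators on the whole of $\wedge^*(M)$. *)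

theory Defs
  imports "HOL-Analysis.Analysis" "HOL-Library.Function_Algebras"
begin

text \<open>
  The model space of a manifold is a type of class \<^class>\<open>real_normed_vector\<close> that is spanned by a
  finite set, rather than one of class \<^class>\<open>euclidean_space\<close>, because the latter excludes
  dimension 0.
\<close>

definition finite_dimensional :: "'e::real_vector itself \<Rightarrow> bool" where
  "finite_dimensional _ \<longleftrightarrow> (\<exists>B::'e set. finite B \<and> span B = UNIV)"

text \<open>
  \<open>C_k\<close> regularity on an open set of a finite-dimensional space: all iterated directional
  derivatives up to order \<open>k\<close> exist as (Frechet) derivatives and are continuous.
\<close>

fun Ck_on :: "nat \<Rightarrow> 'a::real_normed_vector set \<Rightarrow> ('a \<Rightarrow> 'b::real_normed_vector) \<Rightarrow> bool" where
  "Ck_on 0 S f \<longleftrightarrow> continuous_on S f"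
| "Ck_on (Suc k) S f \<longleftrightarrow>
     (\<forall>x\<in>S. f differentiable (at x)) \<and> (\<forall>v. Ck_on k S (\<lambda>x. frechet_derivative f (at x) v))"

definition smooth_on :: "'a::real_normed_vector set \<Rightarrow> ('a \<Rightarrow> 'b::real_normed_vector) \<Rightarrow> bool" where
  "smooth_on S f \<longleftrightarrow> (\<forall>k. Ck_on k S f)"

text \<open>
  A chart is a pair of a domain and a map; the values of the map outside the domain are irrelevant.
  The underlying topological space of the manifold is the whole type \<open>'m\<close>.
\<close>

type_synonym ('m, 'e) chart = "'m set \<times> ('m \<Rightarrow> 'e)"

definition chart_image :: "('m, 'e) chart \<Rightarrow> 'e set" where
  "chart_image c = snd c ` fst c"

definition chart_inv :: "('m, 'e) chart \<Rightarrow> 'e \<Rightarrow> 'm" where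
  "chart_inv c = inv_into (fst c) (snd c)"

definition transition :: "('m, 'e) chart \<Rightarrow> ('m, 'e) chart \<Rightarrow> 'e \<Rightarrow> 'e" where
  "transition c c' = snd c' \<circ> chart_inv c"

definition smooth_atlas ::
    "('m::{t2_space,second_countable_topology}, 'e::real_normed_vector) chart set \<Rightarrow> bool" where
  "smooth_atlas A \<longleftrightarrow>
     finite_dimensional TYPE('e) \<and>
     (\<Union>c\<in>A. fst c) = UNIV \<and>
     (\<forall>c\<in>A. open (fst c) \<and> open (chart_image c) \<and>
            homeomorphism (fst c) (chart_image c) (snd c) (chart_inv c)) \<and>
     (\<forall>c\<in>A. \<forall>c'\<in>A. smooth_on (snd c ` (fst c \<inter> fst c')) (transition c c'))"

definition smooth_functions ::
    "('m::{t2_space,second_countable_topology}, 'e::real_normed_vector) chart set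
      \<Rightarrow> ('m \<Rightarrow> real) set" where
  "smooth_functions A = {f. \<forall>c\<in>A. smooth_on (chart_image c) (f \<circ> chart_inv c)}"

text \<open>
  An element of the exterior algebra \<open>\<Lambda>\<^sup>*(E\<^sup>*)\<close> of the dual of \<open>E\<close> is encoded as one function on lists
  of vectors, whose restriction to the lists of length \<open>p\<close> is its component of degree \<open>p\<close>. If \<open>E\<close>
  is finite-dimensional, the components of degree above the dimension vanish, so that this is the
  direct sum of the spaces of alternating \<open>p\<close>-linear forms.
\<close>

definition alternating :: "('e::real_vector list \<Rightarrow> real) \<Rightarrow> bool" where
  "alternating L \<longleftrightarrow>
     (\<forall>us vs. linear (\<lambda>v. L (us @ v # vs))) \<and> (\<forall>vs. \<not> distinct vs \<longrightarrow> L vs = 0)"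

text \<open>
  A differential form is a family of smooth forms on the images of the charts of the atlas that are
  pulled back to each other by the transition maps. It is made unique by the value 0 at junk
  arguments. Sums of forms are pointwise sums of functions.
\<close>

type_synonym ('m, 'e) form = "('m, 'e) chart \<Rightarrow> 'e \<Rightarrow> 'e list \<Rightarrow> real"

definition forms ::
    "('m::{t2_space,second_countable_topology}, 'e::real_normed_vector) chart set
      \<Rightarrow> ('m, 'e) form set" where
  "forms A = {\<omega>.
     (\<forall>c y. c \<notin> A \<or> y \<notin> chart_image c \<longrightarrow> \<omega> c y = 0) \<and>
     (\<forall>c\<in>A. \<forall>y\<in>chart_image c. alternating (\<omega> c y)) \<and>
     (\<forall>c\<in>A. \<forall>vs. smooth_on (chart_image c) (\<lambda>y. \<omega> c y vs)) \<and>
     (\<forall>c\<in>A. \<forall>c'\<in>A. \<forall>x\<in>fst c \<inter> fst c'. \<forall>vs.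
        \<omega> c (snd c x) vs =
        \<omega> c' (snd c' x) (map (frechet_derivative (transition c c') (at (snd c x))) vs))}"

definition pforms ::
    "('m::{t2_space,second_countable_topology}, 'e::real_normed_vector) chart set
      \<Rightarrow> nat \<Rightarrow> ('m, 'e) form set" where
  "pforms A p = {\<omega> \<in> forms A. \<forall>c y vs. length vs \<noteq> p \<longrightarrow> \<omega> c y vs = 0}"

definition form_scale :: "real \<Rightarrow> ('m, 'e) form \<Rightarrow> ('m, 'e) form" where
  "form_scale r \<omega> = (\<lambda>c y vs. r * \<omega> c y vs)"

definition fun_form ::
    "('m::{t2_space,second_countable_topology}, 'e::real_normed_vector) chart set
      \<Rightarrow> ('m \<Rightarrow> real) \<Rightarrow> ('m, 'e) form" where
  "fun_form A f = (\<lambda>c y vs.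
     if c \<in> A \<and> y \<in> chart_image c \<and> vs = [] then f (chart_inv c y) else 0)"

lemma Ck_on_cong:
  assumes "open S" "\<And>x. x \<in> S \<Longrightarrow> f x = g x" "Ck_on k S f"
  shows "Ck_on k S g"
  using assms(2,3)
proof (induction k arbitrary: f g)
  case 0
  then show ?case
    by (metis Ck_on.simps(1) continuous_on_cong)
next
  case (Suc k)
  have D: "(f has_derivative D) (at x) \<longleftrightarrow> (g has_derivative D) (at x)" if "x \<in> S" for x D
    using Suc.prems(1) assms(1) that
    by (metis has_derivative_transform_within_open)
  have F: "frechet_derivative f (at x) = frechet_derivative g (at x)" if "x \<in> S" for x
    unfolding frechet_derivative_def using D[OF that] by simp
  have "g differentiable (at x)" if "x \<in> S" for x
  proof -
    have "f differentiable (at x)" using Suc.prems(2) that by simp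
    then obtain E where "(f has_derivative E) (at x)" unfolding differentiable_def by blast
    then show ?thesis unfolding differentiable_def using D[OF that] by blast
  qed
  moreover have "Ck_on k S (\<lambda>x. frechet_derivative g (at x) v)" for v
    by (rule Suc.IH[of "\<lambda>x. frechet_derivative f (at x) v"]) (use F Suc.prems(2) in auto)
  ultimately show ?case by simp
qed

lemma smooth_on_cong:
  assumes "open S" "\<And>x. x \<in> S \<Longrightarrow> f x = g x"
  shows "smooth_on S f \<longleftrightarrow> smooth_on S g"
  unfolding smooth_on_def using assms Ck_on_cong by metis

lemma Ck_on_zero: "Ck_on k S (\<lambda>_. 0)"
  by (induction k) (auto simp: frechet_derivative_const)

lemma alternating_degree_0: "alternating (\<lambda>vs. if vs = [] then r else 0)"
  by (auto simp: alternating_def linear_zero)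

lemma pforms_0:
  assumes A: "smooth_atlas A"
  shows "pforms A 0 = fun_form A ` smooth_functions A"
proof -
  have op: "open (chart_image c)" if "c \<in> A" for c
    using A that by (auto simp: smooth_atlas_def)
  have inv: "chart_inv c (snd c x) = x" if "c \<in> A" "x \<in> fst c" for c x
    using A that by (auto simp: smooth_atlas_def homeomorphism_def)
  have inv2: "snd c (chart_inv c y) = y" "chart_inv c y \<in> fst c"
    if "c \<in> A" "y \<in> chart_image c" for c y
    using A that by (auto simp: smooth_atlas_def homeomorphism_def)
  show ?thesis
  proof (intro equalityI subsetI)
    fix \<omega> assume \<omega>: "\<omega> \<in> pforms A 0"
    have "(\<Union>c\<in>A. fst c) = UNIV"
      using A by (simp add: smooth_atlas_def)
    then have "\<forall>x. \<exists>c. c \<in> A \<and> x \<in> fst c"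
      by blast
    then obtain ch where ch: "\<And>x. ch x \<in> A" "\<And>x. x \<in> fst (ch x)"
      by metis
    define f where "f x = \<omega> (ch x) (snd (ch x) x) []" for x
    have f: "f x = \<omega> c (snd c x) []" if "c \<in> A" "x \<in> fst c" for c x
    proof -
      have "\<forall>c\<in>A. \<forall>c'\<in>A. \<forall>x\<in>fst c \<inter> fst c'. \<forall>vs. \<omega> c (snd c x) vs =
        \<omega> c' (snd c' x) (map (frechet_derivative (transition c c') (at (snd c x))) vs)"
        using \<omega> unfolding pforms_def forms_def by blast
      then have "\<omega> (ch x) (snd (ch x) x) [] = \<omega> c (snd c x) (map
          (frechet_derivative (transition (ch x) c) (at (snd (ch x) x))) [])"
        using ch that by (metis IntI)
      then show ?thesis by (simp add: f_def)
    qed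
    have f': "f (chart_inv c y) = \<omega> c y []" if "c \<in> A" "y \<in> chart_image c" for c y
      using f[of c "chart_inv c y"] inv2[OF that] that by simp
    have "f \<in> smooth_functions A"
      unfolding smooth_functions_def
    proof (intro CollectI ballI)
      fix c assume c: "c \<in> A"
      have "smooth_on (chart_image c) (\<lambda>y. \<omega> c y [])"
        using \<omega> c unfolding pforms_def forms_def by blast
      then show "smooth_on (chart_image c) (f \<circ> chart_inv c)"
        using smooth_on_cong[OF op[OF c], of "f \<circ> chart_inv c" "\<lambda>y. \<omega> c y []"] f' c by simp
    qed
    moreover have "\<omega> = fun_form A f"
    proof (intro ext)
      fix c y vs
      have "\<omega> c y vs = 0" if "c \<notin> A \<or> y \<notin> chart_image c \<or> vs \<noteq> []"
      proof -
        have 1: "\<forall>c y. c \<notin> A \<or> y \<notin> chart_image c \<longrightarrow> \<omega> c y = 0"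
          using \<omega> unfolding pforms_def forms_def mem_Collect_eq by (elim conjE)
        have 2: "\<forall>c y vs. length vs \<noteq> 0 \<longrightarrow> \<omega> c y vs = 0"
          using \<omega> unfolding pforms_def mem_Collect_eq by (elim conjE)
        show ?thesis
        proof (cases "vs = []")
          case True
          then have "\<omega> c y = 0" using 1[rule_format, of c y] that by blast
          then show ?thesis by simp
        next
          case False
          then show ?thesis using 2[rule_format, of vs c y] by simp
        qed
      qed
      then show "\<omega> c y vs = fun_form A f c y vs"
        using f' by (auto simp: fun_form_def)
    qed
    ultimately show "\<omega> \<in> fun_form A ` smooth_functions A" by blast
  next
    fix \<omega> assume "\<omega> \<in> fun_form A ` smooth_functions A"
    then obtain f where f: "f \<in> smooth_functions A" and \<omega>: "\<omega> = fun_form A f" by blast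
    have 1: "alternating (\<omega> c y)" if "c \<in> A" "y \<in> chart_image c" for c y
      using alternating_degree_0[of "f (chart_inv c y)"] that by (simp add: \<omega> fun_form_def)
    have 2: "smooth_on (chart_image c) (\<lambda>y. \<omega> c y vs)" if c: "c \<in> A" for c vs
    proof (cases "vs = []")
      case True
      have "smooth_on (chart_image c) (f \<circ> chart_inv c)"
        using f c by (auto simp: smooth_functions_def)
      then show ?thesis
        using smooth_on_cong[OF op[OF c], of "f \<circ> chart_inv c" "\<lambda>y. \<omega> c y vs"] True c
        by (simp add: \<omega> fun_form_def)
    next
      case False
      then show ?thesis by (simp add: \<omega> fun_form_def smooth_on_def Ck_on_zero)
    qed
    have 3: "\<omega> c (snd c x) vs = \<omega> c' (snd c' x)
        (map (frechet_derivative (transition c c') (at (snd c x))) vs)"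
      if "c \<in> A" "c' \<in> A" "x \<in> fst c \<inter> fst c'" for c c' x vs
      using that inv by (auto simp: \<omega> fun_form_def chart_image_def)
    show "\<omega> \<in> pforms A 0"
      unfolding pforms_def forms_def mem_Collect_eq
    proof (intro conjI)
      show "\<forall>c y. c \<notin> A \<or> y \<notin> chart_image c \<longrightarrow> \<omega> c y = 0"
        by (auto simp: \<omega> fun_form_def fun_eq_iff)
      show "\<forall>c y vs. length vs \<noteq> 0 \<longrightarrow> \<omega> c y vs = 0"
        by (simp add: \<omega> fun_form_def)
    qed (use 1 2 3 in blast)+
  qed
qed

text \<open>
  The exterior product is the sum over shuffles: the set \<open>S\<close> of positions gives the arguments of the
  first factor, its complement those of the second. Since \<open>S\<close> may have any size, this is the bilinear
  product on forms of mixed degree.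
\<close>

definition shuffle_sign :: "nat \<Rightarrow> nat set \<Rightarrow> real" where
  "shuffle_sign n S = (- 1) ^ card {(i, j). i < j \<and> j < n \<and> i \<notin> S \<and> j \<in> S}"

definition wedge :: "('m, 'e) form \<Rightarrow> ('m, 'e) form \<Rightarrow> ('m, 'e) form" where
  "wedge \<alpha> \<beta> = (\<lambda>c y vs. \<Sum>S\<in>Pow {..<length vs}.
     shuffle_sign (length vs) S * \<alpha> c y (nths vs S) * \<beta> c y (nths vs (- S)))"

definition ext_deriv ::
    "('m::{t2_space,second_countable_topology}, 'e::real_normed_vector) chart set
      \<Rightarrow> ('m, 'e) form \<Rightarrow> ('m, 'e) form" where
  "ext_deriv A \<omega> = (\<lambda>c y vs.
     if c \<in> A \<and> y \<in> chart_image c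
     then \<Sum>i<length vs. (- 1) ^ i *
            frechet_derivative (\<lambda>z. \<omega> c z (take i vs @ drop (Suc i) vs)) (at y) (vs ! i)
     else 0)"

lemma wedge_fun_form: "wedge (fun_form A f) (fun_form A g) = fun_form A (\<lambda>x. f x * g x)"
proof (intro ext)
  fix c y and vs :: "'b list"
  have *: "fun_form A f c y (nths vs S) * fun_form A g c y (nths vs (- S)) = 0"
    if "vs \<noteq> []" for S
    using that by (cases vs; cases "0 \<in> S") (simp_all add: fun_form_def nths_Cons)
  have "vs \<noteq> [] \<Longrightarrow> wedge (fun_form A f) (fun_form A g) c y vs = 0"
    unfolding wedge_def mult.assoc
    by (intro sum.neutral ballI) (simp add: *)
  moreover have "vs \<noteq> [] \<Longrightarrow> fun_form A (\<lambda>x. f x * g x) c y vs = 0"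
    by (simp add: fun_form_def)
  moreover have "wedge (fun_form A f) (fun_form A g) c y [] = fun_form A (\<lambda>x. f x * g x) c y []"
    by (simp add: wedge_def shuffle_sign_def fun_form_def)
  ultimately show "wedge (fun_form A f) (fun_form A g) c y vs = fun_form A (\<lambda>x. f x * g x) c y vs"
    by (cases "vs = []") auto
qed

end

theory Submission imports Defs begin

text \<open>
  Let \<open>f\<close> be a function with \<open>\<delta> f = 0\<close>. Then \<open>df\<close> is in \<open>Im d\<close>, it is closed, and
  \<open>\<delta> df = - d \<delta> f = 0\<close>. The \<open>d\<delta>\<close>-lemma therefore gives a form \<open>\<alpha>\<close>, possibly of mixed degree, with
  \<open>df = d \<delta> \<alpha>\<close>. But \<open>d \<delta>\<close> raises degrees by 2, so \<open>d \<delta> \<alpha>\<close> has no part of degree 1, whereas \<open>df\<close> has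
  no other part. Hence \<open>df = 0\<close>, and \<open>f\<close> is constant because the manifold is connected. Conversely,
  a derivation kills the unit, and so by linearity all constants.

  Two points carry the weight. That \<open>\<delta> \<alpha>\<close> has no part of degree 0
  (\<open>degree_raising_no_degree_0\<close>) requires \<open>\<alpha>\<close> to be a finite sum of homogeneous forms, that is, forms
  to vanish above the dimension (\<open>alternating_vanishes_above_dimension\<close>). That \<open>df\<close> is a closed form
  requires the chain rule (\<open>ext_deriv_pforms_0_in_forms\<close>) and the symmetry of second derivatives
  (\<open>second_derivative_symmetric\<close>, \<open>ext_deriv_ext_deriv_pforms_0\<close>).
\<close>

section \<open>Second derivatives and linear algebra\<close>

lemma has_real_derivative_along_line:
  fixes f :: "'a::real_normed_vector \<Rightarrow> real"
  assumes "f differentiable (at (a + s *\<^sub>R v))"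
  shows "((\<lambda>s. f (a + s *\<^sub>R v)) has_real_derivative
           frechet_derivative f (at (a + s *\<^sub>R v)) v) (at s)"
proof -
  have f: "(f has_derivative frechet_derivative f (at (a + s *\<^sub>R v))) (at (a + s *\<^sub>R v))"
    using assms frechet_derivative_works by blast
  have l: "((\<lambda>s. a + s *\<^sub>R v) has_derivative (\<lambda>h. h *\<^sub>R v)) (at s)"
    by (auto intro!: derivative_eq_intros)
  have "linear (frechet_derivative f (at (a + s *\<^sub>R v)))"
    using assms linear_frechet_derivative by blast
  then have "frechet_derivative f (at (a + s *\<^sub>R v)) \<circ> (\<lambda>h. h *\<^sub>R v)
      = (*) (frechet_derivative f (at (a + s *\<^sub>R v)) v)"
    by (auto simp: fun_eq_iff linear_cmul)
  then show ?thesis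
    using diff_chain_at[OF l f] by (simp add: has_field_derivative_def o_def)
qed

lemma second_difference_mean_value:
  fixes f :: "'a::real_normed_vector \<Rightarrow> real"
  assumes e: "0 < e"
    and S: "\<And>s t. 0 \<le> s \<Longrightarrow> s \<le> e \<Longrightarrow> 0 \<le> t \<Longrightarrow> t \<le> e \<Longrightarrow> y + s *\<^sub>R v + t *\<^sub>R w \<in> S"
    and f: "\<And>z. z \<in> S \<Longrightarrow> f differentiable (at z)"
    and f': "\<And>z. z \<in> S \<Longrightarrow> (\<lambda>z. frechet_derivative f (at z) v) differentiable (at z)"
  shows "\<exists>s t. 0 \<le> s \<and> s \<le> e \<and> 0 \<le> t \<and> t \<le> e \<and>
    f (y + e *\<^sub>R v + e *\<^sub>R w) - f (y + e *\<^sub>R v) - f (y + e *\<^sub>R w) + f y =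
    e * (e * frechet_derivative (\<lambda>z. frechet_derivative f (at z) v)
      (at (y + s *\<^sub>R v + t *\<^sub>R w)) w)"
proof -
  define g where "g s = f ((y + e *\<^sub>R w) + s *\<^sub>R v) - f (y + s *\<^sub>R v)" for s
  have "DERIV g s :> frechet_derivative f (at ((y + e *\<^sub>R w) + s *\<^sub>R v)) v -
      frechet_derivative f (at (y + s *\<^sub>R v)) v" if "0 \<le> s" "s \<le> e" for s
    unfolding g_def
    using S[OF that, of e] S[OF that, of 0] e
    by (intro DERIV_diff has_real_derivative_along_line f) (auto simp: algebra_simps)
  from MVT2[OF e this] obtain s where s: "0 < s" "s < e" and gs: "g e - g 0 = (e - 0) *
      (frechet_derivative f (at ((y + e *\<^sub>R w) + s *\<^sub>R v)) v -
       frechet_derivative f (at (y + s *\<^sub>R v)) v)"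
    by blast
  define h where "h t = frechet_derivative f (at ((y + s *\<^sub>R v) + t *\<^sub>R w)) v" for t
  have "DERIV h t :> frechet_derivative (\<lambda>z. frechet_derivative f (at z) v)
      (at ((y + s *\<^sub>R v) + t *\<^sub>R w)) w" if "0 \<le> t" "t \<le> e" for t
    unfolding h_def
    using S[of s t] s that by (intro has_real_derivative_along_line f') auto
  from MVT2[OF e this] obtain t where t: "0 < t" "t < e" and ht: "h e - h 0 = (e - 0) *
      frechet_derivative (\<lambda>z. frechet_derivative f (at z) v) (at ((y + s *\<^sub>R v) + t *\<^sub>R w)) w"
    by blast
  have "f (y + e *\<^sub>R v + e *\<^sub>R w) - f (y + e *\<^sub>R v) - f (y + e *\<^sub>R w) + f y = g e - g 0"
    by (simp add: g_def algebra_simps)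
  also have "\<dots> = e * (h e - h 0)"
    using gs by (simp add: h_def algebra_simps)
  finally show ?thesis
    using s t ht by (intro exI[of _ s] exI[of _ t]) auto
qed

text \<open>
  The second difference over a small parallelogram is \<open>e\<^sup>2\<close> times a value of either mixed derivative
  at a nearby point, by the mean value theorem; continuity lets both values tend to those at \<open>y\<close>.
\<close>

lemma second_derivative_symmetric:
  fixes f :: "'a::real_normed_vector \<Rightarrow> real"
  assumes S: "open S" "y \<in> S" and f: "Ck_on 2 S f"
  shows "frechet_derivative (\<lambda>z. frechet_derivative f (at z) v) (at y) w =
         frechet_derivative (\<lambda>z. frechet_derivative f (at z) w) (at y) v"
proof -
  define D where "D v w z = frechet_derivative (\<lambda>z. frechet_derivative f (at z) v) (at z) w" for v w z
  have f1: "f differentiable (at z)" if "z \<in> S" for z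
    using f that by (simp add: numeral_2_eq_2)
  have f2: "(\<lambda>z. frechet_derivative f (at z) v) differentiable (at z)" if "z \<in> S" for z v
    using f that by (simp add: numeral_2_eq_2)
  have cont: "continuous_on S (D v w)" for v w
    using f by (simp add: numeral_2_eq_2 D_def[abs_def])
  have "dist (D v w y) (D w v y) \<le> \<epsilon>" if \<epsilon>: "\<epsilon> > 0" for \<epsilon>
  proof -
    have "\<exists>r>0. \<forall>z\<in>S. dist z y < r \<longrightarrow> dist (D v w z) (D v w y) < \<epsilon> / 2" for v w
      using cont[of v w] S(2) \<epsilon> unfolding continuous_on_iff by (meson half_gt_zero)
    then obtain r1 r2 where r: "r1 > 0" "r2 > 0"
      and r1: "\<And>z. z \<in> S \<Longrightarrow> dist z y < r1 \<Longrightarrow> dist (D v w z) (D v w y) < \<epsilon> / 2"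
      and r2: "\<And>z. z \<in> S \<Longrightarrow> dist z y < r2 \<Longrightarrow> dist (D w v z) (D w v y) < \<epsilon> / 2"
      by metis
    obtain r3 where r3: "r3 > 0" "ball y r3 \<subseteq> S"
      using S open_contains_ball by blast
    define r where "r = min r1 (min r2 r3)"
    have r0: "r > 0" using r r3 by (simp add: r_def)
    \<comment> \<open>The parallelogram with sides \<open>e v\<close> and \<open>e w\<close> lies in the ball of radius \<open>r\<close> around \<open>y\<close>.\<close>
    define e where "e = r / (norm v + norm w + 1)"
    have nn: "norm v + norm w + 1 > 0" by (simp add: add_nonneg_pos)
    have e: "e > 0" using r0 nn by (simp add: e_def)
    have near: "dist (y + s *\<^sub>R v + t *\<^sub>R w) y < r" if "0 \<le> s" "s \<le> e" "0 \<le> t" "t \<le> e" for s t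
    proof -
      have "dist (y + s *\<^sub>R v + t *\<^sub>R w) y = norm (s *\<^sub>R v + t *\<^sub>R w)"
        by (simp add: dist_norm algebra_simps)
      also have "\<dots> \<le> s * norm v + t * norm w"
        using norm_triangle_ineq[of "s *\<^sub>R v" "t *\<^sub>R w"] that by simp
      also have "\<dots> \<le> e * norm v + e * norm w"
        using that by (intro add_mono mult_right_mono) auto
      also have "\<dots> < e * (norm v + norm w + 1)"
        using e by (simp add: algebra_simps)
      also have "\<dots> = r" using nn by (simp add: e_def)
      finally show ?thesis .
    qed
    have inS: "y + s *\<^sub>R v + t *\<^sub>R w \<in> S" if "0 \<le> s" "s \<le> e" "0 \<le> t" "t \<le> e" for s t
      using near[OF that] r3 by (auto simp: r_def dist_commute subset_iff)
    have inS': "y + s *\<^sub>R w + t *\<^sub>R v \<in> S" if "0 \<le> s" "s \<le> e" "0 \<le> t" "t \<le> e" for s t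
      using inS[of t s] that by (simp add: algebra_simps)
    obtain s t where st: "0 \<le> s" "s \<le> e" "0 \<le> t" "t \<le> e" and
      1: "f (y + e *\<^sub>R v + e *\<^sub>R w) - f (y + e *\<^sub>R v) - f (y + e *\<^sub>R w) + f y =
        e * (e * D v w (y + s *\<^sub>R v + t *\<^sub>R w))"
      using second_difference_mean_value[of e y v w S f, OF e inS f1 f2] unfolding D_def by blast
    obtain s' t' where st': "0 \<le> s'" "s' \<le> e" "0 \<le> t'" "t' \<le> e" and
      2: "f (y + e *\<^sub>R w + e *\<^sub>R v) - f (y + e *\<^sub>R w) - f (y + e *\<^sub>R v) + f y =
        e * (e * D w v (y + s' *\<^sub>R w + t' *\<^sub>R v))"
      using second_difference_mean_value[of e y w v S f, OF e inS' f1 f2] unfolding D_def by blast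
    have "f (y + e *\<^sub>R w + e *\<^sub>R v) = f (y + e *\<^sub>R v + e *\<^sub>R w)"
      by (simp add: algebra_simps)
    with 1 2 have "e * (e * D v w (y + s *\<^sub>R v + t *\<^sub>R w)) =
        e * (e * D w v (y + s' *\<^sub>R w + t' *\<^sub>R v))"
      by linarith
    then have eq: "D v w (y + s *\<^sub>R v + t *\<^sub>R w) = D w v (y + s' *\<^sub>R w + t' *\<^sub>R v)"
      using e by simp
    have "dist (D v w (y + s *\<^sub>R v + t *\<^sub>R w)) (D v w y) < \<epsilon> / 2"
      using r1[OF inS[OF st]] near[OF st] by (simp add: r_def)
    moreover have "dist (D w v (y + s' *\<^sub>R w + t' *\<^sub>R v)) (D w v y) < \<epsilon> / 2"
      using r2[OF inS'[OF st']] near[OF st'(3,4,1,2)] by (simp add: r_def algebra_simps)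
    ultimately show ?thesis
      unfolding eq by (smt (verit) dist_triangle2 dist_commute field_sum_of_halves)
  qed
  then have "dist (D v w y) (D w v y) \<le> 0"
    by (rule field_le_epsilon[where y = 0, simplified])
  then show ?thesis by (simp add: D_def)
qed

text \<open>
  Among more vectors than the dimension one depends on the others, and inserting the others in its
  slot gives 0. Thus forms have bounded degree, which is what makes every form a finite sum of
  homogeneous ones.
\<close>

lemma alternating_vanishes_above_dimension:
  assumes "finite_dimensional TYPE('e::real_vector)"
  shows "\<exists>n. \<forall>L. \<forall>vs::'e list. alternating L \<longrightarrow> n < length vs \<longrightarrow> L vs = 0"
proof -
  obtain B :: "'e set" where B: "finite B" "span B = UNIV"
    using assms by (auto simp: finite_dimensional_def)
  have "L vs = 0" if L: "alternating L" and len: "card B < length vs" for L and vs :: "'e list"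
  proof (cases "distinct vs")
    case True
    then have "card B < card (set vs)" using len by (simp add: distinct_card)
    then have "dependent (set vs)"
      using independent_span_bound[of B "set vs"] B by auto
    then obtain a where a: "a \<in> set vs" "a \<in> span (set vs - {a})"
      by (auto simp: dependent_def)
    then obtain us ws where vs: "vs = us @ a # ws" by (meson split_list)
    have "a \<in> span (set us \<union> set ws)"
      using a(2) True unfolding vs by (rule_tac span_mono[THEN subsetD]) auto
    moreover have "linear (\<lambda>v. L (us @ v # ws))"
      using L by (simp add: alternating_def)
    moreover have "L (us @ v # ws) = 0" if "v \<in> set us \<union> set ws" for v
      using L that by (auto simp: alternating_def)
    ultimately show ?thesis
      unfolding vs by (rule_tac linear_eq_0_on_span) auto
  qed (use L in \<open>simp add: alternating_def\<close>)
  then show ?thesis by blast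
qed

section \<open>Homogeneous parts\<close>

text \<open>
  A predicate on degrees, rather than one degree, gives both the homogeneous parts and the truncations
  by which a form is built up from them.
\<close>

definition degree_part :: "(nat \<Rightarrow> bool) \<Rightarrow> ('m, 'e) form \<Rightarrow> ('m, 'e) form" where
  "degree_part P \<alpha> = (\<lambda>c y vs. if P (length vs) then \<alpha> c y vs else 0)"

lemma pforms_other_degree:
  "\<omega> \<in> pforms A p \<Longrightarrow> length vs \<noteq> p \<Longrightarrow> \<omega> c y vs = 0"
  unfolding pforms_def mem_Collect_eq by meson

lemma smooth_on_zero: "smooth_on S (\<lambda>_. 0)"
  by (simp add: smooth_on_def Ck_on_zero)

lemma degree_part_in_forms:
  assumes "\<alpha> \<in> forms A"
  shows "degree_part P \<alpha> \<in> forms A"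
proof -
  have 1: "degree_part P \<alpha> c y = 0" if "c \<notin> A \<or> y \<notin> chart_image c" for c y
  proof -
    have "\<alpha> c y = 0" using assms that unfolding forms_def mem_Collect_eq by meson
    then show ?thesis by (auto simp: degree_part_def)
  qed
  have 2: "alternating (degree_part P \<alpha> c y)" if "c \<in> A" "y \<in> chart_image c" for c y
  proof -
    have L: "alternating (\<alpha> c y)" using assms that unfolding forms_def by blast
    have "linear (\<lambda>v. degree_part P \<alpha> c y (us @ v # vs))" for us vs
    proof (cases "P (length us + Suc (length vs))")
      case True
      then show ?thesis using L by (simp add: degree_part_def alternating_def)
    next
      case False
      then show ?thesis by (simp add: degree_part_def linear_zero)
    qed
    then show ?thesis using L by (simp add: degree_part_def alternating_def)
  qed
  have 3: "smooth_on (chart_image c) (\<lambda>y. degree_part P \<alpha> c y vs)" if "c \<in> A" for c vs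
  proof -
    have "smooth_on (chart_image c) (\<lambda>y. \<alpha> c y vs)"
      using assms that unfolding forms_def by blast
    then show ?thesis by (cases "P (length vs)") (simp_all add: degree_part_def smooth_on_zero)
  qed
  have 4: "degree_part P \<alpha> c (snd c x) vs = degree_part P \<alpha> c' (snd c' x)
      (map (frechet_derivative (transition c c') (at (snd c x))) vs)"
    if "c \<in> A" "c' \<in> A" "x \<in> fst c \<inter> fst c'" for c c' x vs
  proof -
    have "\<alpha> c (snd c x) vs = \<alpha> c' (snd c' x)
      (map (frechet_derivative (transition c c') (at (snd c x))) vs)"
      using assms that unfolding forms_def by blast
    then show ?thesis by (simp add: degree_part_def)
  qed
  show ?thesis
    unfolding forms_def mem_Collect_eq using 1 2 3 4 by (intro conjI) blast+
qed

lemma degree_part_eq_in_pforms: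
  "\<alpha> \<in> forms A \<Longrightarrow> degree_part (\<lambda>q. q = p) \<alpha> \<in> pforms A p"
  unfolding pforms_def using degree_part_in_forms by (auto simp: degree_part_def)

lemma zero_in_forms:
  assumes "\<alpha> \<in> forms A"
  shows "0 \<in> forms A"
proof -
  have "degree_part (\<lambda>_. False) \<alpha> = 0" by (auto simp: degree_part_def fun_eq_iff)
  then show ?thesis using degree_part_in_forms[OF assms, of "\<lambda>_. False"] by simp
qed

text \<open>
  There is nothing of degree \<open>- 1\<close> that could be mapped to degree 0. Additivity
  carries this over to finite sums of homogeneous forms, and every form is such a sum.
\<close>

lemma degree_raising_no_degree_0:
  fixes \<delta> :: "('m::{t2_space,second_countable_topology}, 'e::real_normed_vector) form
    \<Rightarrow> ('m, 'e) form"
  assumes A: "smooth_atlas A"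
    and add: "\<And>\<alpha> \<beta>. \<alpha> \<in> forms A \<Longrightarrow> \<beta> \<in> forms A \<Longrightarrow> \<delta> (\<alpha> + \<beta>) = \<delta> \<alpha> + \<delta> \<beta>"
    and deg: "\<And>p \<alpha>. \<alpha> \<in> pforms A p \<Longrightarrow> \<delta> \<alpha> \<in> pforms A (p + 1)"
    and \<alpha>: "\<alpha> \<in> forms A"
  shows "\<delta> \<alpha> c y [] = 0"
proof -
  have part: "\<delta> (degree_part (\<lambda>q. q < n) \<alpha>) c y [] = 0" for n
  proof (induction n)
    case 0
    have "degree_part (\<lambda>q. q < 0) \<alpha> = degree_part (\<lambda>q. q = 0) (0 :: ('m, 'e) form)"
      by (auto simp: degree_part_def fun_eq_iff)
    then have "degree_part (\<lambda>q. q < 0) \<alpha> \<in> pforms A 0"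
      using degree_part_eq_in_pforms[OF zero_in_forms[OF \<alpha>]] by metis
    from pforms_other_degree[OF deg[OF this], of "[]"] show ?case by simp
  next
    case (Suc n)
    have "degree_part (\<lambda>q. q < Suc n) \<alpha> =
        degree_part (\<lambda>q. q < n) \<alpha> + degree_part (\<lambda>q. q = n) \<alpha>"
      by (auto simp: degree_part_def fun_eq_iff)
    then have "\<delta> (degree_part (\<lambda>q. q < Suc n) \<alpha>) =
        \<delta> (degree_part (\<lambda>q. q < n) \<alpha>) + \<delta> (degree_part (\<lambda>q. q = n) \<alpha>)"
      using add[OF degree_part_in_forms[OF \<alpha>] degree_part_in_forms[OF \<alpha>]] by presburger
    moreover have "\<delta> (degree_part (\<lambda>q. q = n) \<alpha>) c y [] = 0"
      using pforms_other_degree[OF deg[OF degree_part_eq_in_pforms[OF \<alpha>, of n]]] by simp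
    ultimately show ?case
      using Suc by simp
  qed
  \<comment> \<open>Above the dimension \<open>\<alpha>\<close> vanishes, hence some truncation of \<open>\<alpha>\<close> is \<open>\<alpha>\<close> itself.\<close>
  obtain n where n: "\<And>L. \<And>vs::'e list. alternating L \<Longrightarrow> n < length vs \<Longrightarrow> L vs = 0"
    using alternating_vanishes_above_dimension A unfolding smooth_atlas_def by metis
  have "\<alpha> c y vs = 0" if "n < length vs" for c y vs
  proof (cases "c \<in> A \<and> y \<in> chart_image c")
    case True
    then have "alternating (\<alpha> c y)" using \<alpha> unfolding forms_def by blast
    then show ?thesis using n that by blast
  next
    case False
    then have "\<alpha> c y = 0" using \<alpha> unfolding forms_def mem_Collect_eq by meson
    then show ?thesis by simp
  qed
  then have "degree_part (\<lambda>q. q < Suc n) \<alpha> = \<alpha>"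
    by (auto simp: degree_part_def fun_eq_iff)
  then show ?thesis using part[of "Suc n"] by simp
qed

section \<open>The differential of a function\<close>

lemma ext_deriv_pforms_0:
  assumes "\<omega> \<in> pforms A 0"
  shows "ext_deriv A \<omega> c y vs = (if c \<in> A \<and> y \<in> chart_image c \<and> length vs = 1
    then frechet_derivative (\<lambda>z. \<omega> c z []) (at y) (vs ! 0) else 0)"
proof -
  have z: "\<omega> c z us = 0" if "us \<noteq> []" for z us
    using pforms_other_degree[OF assms] that by simp
  have "(\<Sum>i<length vs. (- 1) ^ i *
      frechet_derivative (\<lambda>z. \<omega> c z (take i vs @ drop (Suc i) vs)) (at y) (vs ! i)) = 0"
    if "length vs \<noteq> 1"
  proof (intro sum.neutral ballI)
    fix i assume i: "i \<in> {..<length vs}"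
    have "length (take i vs @ drop (Suc i) vs) = length vs - 1" using i by auto
    moreover have "length vs - 1 > 0" using i that by auto
    ultimately have "take i vs @ drop (Suc i) vs \<noteq> []" by (metis length_greater_0_conv)
    then have "(\<lambda>z. \<omega> c z (take i vs @ drop (Suc i) vs)) = (\<lambda>_. 0)" using z by blast
    then show "(- 1) ^ i *
      frechet_derivative (\<lambda>z. \<omega> c z (take i vs @ drop (Suc i) vs)) (at y) (vs ! i) = 0"
      by (simp add: frechet_derivative_const)
  qed
  then show ?thesis by (auto simp: ext_deriv_def)
qed

lemma smooth_on_differentiable:
  "smooth_on S f \<Longrightarrow> x \<in> S \<Longrightarrow> f differentiable (at x)"
  unfolding smooth_on_def by (metis Ck_on.simps(2))

lemma smooth_on_frechet_derivative:
  "smooth_on S f \<Longrightarrow> smooth_on S (\<lambda>x. frechet_derivative f (at x) v)"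
  unfolding smooth_on_def by (metis Ck_on.simps(2))

lemma frechet_derivative_cong_open:
  assumes "open S" "x \<in> S" "\<And>z. z \<in> S \<Longrightarrow> f z = g z"
  shows "frechet_derivative f (at x) = frechet_derivative g (at x)"
proof -
  have "(f has_derivative D) (at x) \<longleftrightarrow> (g has_derivative D) (at x)" for D
    using assms by (metis has_derivative_transform_within_open)
  then show ?thesis by (simp add: frechet_derivative_def)
qed

lemma smooth_atlas_chart:
  assumes "smooth_atlas A" "c \<in> A"
  shows "open (fst c)" "open (chart_image c)"
    "homeomorphism (fst c) (chart_image c) (snd c) (chart_inv c)"
    "x \<in> fst c \<Longrightarrow> chart_inv c (snd c x) = x"
    "x \<in> fst c \<Longrightarrow> snd c x \<in> chart_image c"
proof -
  show *: "open (fst c)" "open (chart_image c)"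
    "homeomorphism (fst c) (chart_image c) (snd c) (chart_inv c)"
    using assms by (auto simp: smooth_atlas_def)
  show "x \<in> fst c \<Longrightarrow> chart_inv c (snd c x) = x"
    using *(3) by (simp add: homeomorphism_def)
  show "x \<in> fst c \<Longrightarrow> snd c x \<in> chart_image c"
    by (simp add: chart_image_def)
qed

lemma open_chart_overlap:
  assumes A: "smooth_atlas A" and c: "c \<in> A" "c' \<in> A"
  shows "open (snd c ` (fst c \<inter> fst c'))"
proof -
  have "openin (top_of_set (fst c)) (fst c \<inter> fst c')"
    using smooth_atlas_chart(1)[OF A c(2)] by (simp add: openin_open_Int)
  then have "openin (top_of_set (chart_image c)) (snd c ` (fst c \<inter> fst c'))"
    using homeomorphism_imp_open_map[OF smooth_atlas_chart(3)[OF A c(1)]] by blast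
  then show ?thesis
    using smooth_atlas_chart(2)[OF A c(1)] openin_open_eq by blast
qed

text \<open>
  The differential of a function is an element of the complex: the chain rule makes its
  representatives in two charts agree.
\<close>

lemma ext_deriv_pforms_0_in_forms:
  assumes A: "smooth_atlas A" and \<omega>: "\<omega> \<in> pforms A 0"
  shows "ext_deriv A \<omega> \<in> forms A"
proof -
  note d = ext_deriv_pforms_0[OF \<omega>]
  have sm: "smooth_on (chart_image c) (\<lambda>y. \<omega> c y [])" if "c \<in> A" for c
    using \<omega> that unfolding pforms_def forms_def by blast
  have dif: "(\<lambda>y. \<omega> c y []) differentiable (at y)" if "c \<in> A" "y \<in> chart_image c" for c y
    using sm that smooth_on_differentiable by blast
  have 1: "ext_deriv A \<omega> c y = 0" if "c \<notin> A \<or> y \<notin> chart_image c" for c y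
    using that by (auto simp: fun_eq_iff d)
  have 2: "alternating (ext_deriv A \<omega> c y)" if c: "c \<in> A" "y \<in> chart_image c" for c y
  proof -
    have "linear (frechet_derivative (\<lambda>z. \<omega> c z []) (at y))"
      using dif[OF c] linear_frechet_derivative by blast
    then have "linear (\<lambda>v. ext_deriv A \<omega> c y (us @ v # vs))" for us vs
      using c by (cases "us = [] \<and> vs = []") (auto simp: d linear_zero)
    moreover have "ext_deriv A \<omega> c y vs = 0" if "\<not> distinct vs" for vs
      using that by (cases vs) (auto simp: d)
    ultimately show ?thesis by (simp add: alternating_def)
  qed
  have 3: "smooth_on (chart_image c) (\<lambda>y. ext_deriv A \<omega> c y vs)" if c: "c \<in> A" for c vs
  proof (cases "length vs = 1")
    case True
    show ?thesis
      using smooth_on_cong[OF smooth_atlas_chart(2)[OF A c], of "\<lambda>y. ext_deriv A \<omega> c y vs"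
          "\<lambda>y. frechet_derivative (\<lambda>z. \<omega> c z []) (at y) (vs ! 0)"]
        smooth_on_frechet_derivative[OF sm[OF c]] c True by (simp add: d)
  qed (simp add: d smooth_on_zero)
  have 4: "ext_deriv A \<omega> c (snd c x) vs = ext_deriv A \<omega> c' (snd c' x)
      (map (frechet_derivative (transition c c') (at (snd c x))) vs)"
    if c: "c \<in> A" "c' \<in> A" "x \<in> fst c \<inter> fst c'" for c c' x vs
  proof -
    let ?T = "transition c c'" and ?y = "snd c x" and ?U = "snd c ` (fst c \<inter> fst c')"
    have T: "?T (snd c z) = snd c' z" if "z \<in> fst c" for z
      using that smooth_atlas_chart(4)[OF A c(1)] by (simp add: transition_def)
    have "smooth_on ?U ?T" using A c by (auto simp: smooth_atlas_def)
    then have dT: "?T differentiable (at ?y)"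
      using c(3) smooth_on_differentiable by blast
    have comp: "\<omega> c (snd c z) [] = \<omega> c' (snd c' z) []" if "z \<in> fst c \<inter> fst c'" for z
    proof -
      have "\<omega> c (snd c z) [] = \<omega> c' (snd c' z)
          (map (frechet_derivative ?T (at (snd c z))) [])"
        using \<omega> c(1,2) that unfolding pforms_def forms_def by blast
      then show ?thesis by simp
    qed
    have im: "?y \<in> chart_image c" "snd c' x \<in> chart_image c'"
      using c smooth_atlas_chart(5)[OF A] by auto
    have "frechet_derivative (\<lambda>z. \<omega> c z []) (at ?y) =
        frechet_derivative ((\<lambda>z. \<omega> c' z []) \<circ> ?T) (at ?y)"
      using c(3) comp T
      by (intro frechet_derivative_cong_open[OF open_chart_overlap[OF A c(1,2)]]) auto
    also have "\<dots> = frechet_derivative (\<lambda>z. \<omega> c' z []) (at (?T ?y)) \<circ> frechet_derivative ?T (at ?y)"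
    proof (rule frechet_derivative_compose[OF dT])
      show "(\<lambda>z. \<omega> c' z []) differentiable (at (?T ?y))"
        using dif[OF c(2) im(2)] T c(3) by simp
    qed
    finally have "frechet_derivative (\<lambda>z. \<omega> c z []) (at ?y) =
      frechet_derivative (\<lambda>z. \<omega> c' z []) (at (snd c' x)) \<circ> frechet_derivative ?T (at ?y)"
      using T c(3) by simp
    then show ?thesis
      using c im by (auto simp: d)
  qed
  show ?thesis
    unfolding forms_def mem_Collect_eq using 1 2 3 4 by (intro conjI) blast+
qed

text \<open>
  On a pair of vectors \<open>dd\<omega>\<close> is the difference of the two mixed second derivatives of \<open>\<omega>\<close>.
\<close>

lemma ext_deriv_ext_deriv_pforms_0:
  assumes A: "smooth_atlas A" and \<omega>: "\<omega> \<in> pforms A 0"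
  shows "ext_deriv A (ext_deriv A \<omega>) = 0"
proof (intro ext)
  fix c y and vs :: "'b list"
  note d = ext_deriv_pforms_0[OF \<omega>]
  let ?D = "\<lambda>u. frechet_derivative (\<lambda>z. ext_deriv A \<omega> c z u) (at y)"
  have "(\<Sum>i<length vs. (- 1) ^ i * ?D (take i vs @ drop (Suc i) vs) (vs ! i)) = 0"
    if c: "c \<in> A" "y \<in> chart_image c"
  proof (cases "length vs = 2")
    case True
    then obtain u v where vs: "vs = [u, v]"
      by (metis (no_types, opaque_lifting) Suc_length_conv length_0_conv numeral_2_eq_2)
    let ?f = "\<lambda>z. \<omega> c z []"
    have D: "?D [u] = frechet_derivative (\<lambda>z. frechet_derivative ?f (at z) u) (at y)" for u
      using c by (intro frechet_derivative_cong_open[OF smooth_atlas_chart(2)[OF A c(1)] c(2)])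
        (simp add: d)
    have "smooth_on (chart_image c) ?f"
      using \<omega> c unfolding pforms_def forms_def by blast
    then have "?D [v] u = ?D [u] v"
      unfolding D using smooth_atlas_chart(2)[OF A c(1)] c(2)
      by (intro second_derivative_symmetric) (auto simp: smooth_on_def)
    then show ?thesis by (simp add: vs numeral_2_eq_2)
  next
    case False
    show ?thesis
    proof (intro sum.neutral ballI)
      fix i assume i: "i \<in> {..<length vs}"
      then have "length (take i vs @ drop (Suc i) vs) \<noteq> 1" using False by auto
      then show "(- 1) ^ i * ?D (take i vs @ drop (Suc i) vs) (vs ! i) = 0"
        by (simp add: d frechet_derivative_const)
    qed
  qed
  then show "ext_deriv A (ext_deriv A \<omega>) c y vs = 0 c y vs"
    by (simp add: ext_deriv_def[of A "ext_deriv A \<omega>"])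
qed

text \<open>
  A vanishing derivative makes the function constant on each ball in a chart, hence locally constant
  on the connected manifold.
\<close>

lemma ext_deriv_fun_form_eq_0_imp_constant:
  fixes A :: "('m::{t2_space,second_countable_topology}, 'e::real_normed_vector) chart set"
  assumes A: "smooth_atlas A" and conn: "connected (UNIV :: 'm set)"
    and f: "f \<in> smooth_functions A" and d0: "ext_deriv A (fun_form A f) = 0"
  shows "\<exists>r. f = (\<lambda>_. r)"
proof -
  have "\<exists>T. openin (top_of_set UNIV) T \<and> a \<in> T \<and> (\<forall>x\<in>T. f x = f a)" for a
  proof -
    obtain c where c: "c \<in> A" "a \<in> fst c"
      using A unfolding smooth_atlas_def by blast
    note ch = smooth_atlas_chart[OF A c(1)]
    obtain r where r: "r > 0" "ball (snd c a) r \<subseteq> chart_image c"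
      using ch(2) ch(5)[OF c(2)] open_contains_ball by blast
    have p0: "fun_form A f \<in> pforms A 0" using f pforms_0[OF A] by blast
    have "((f \<circ> chart_inv c) has_derivative (\<lambda>_. 0)) (at y)" if y: "y \<in> chart_image c" for y
    proof -
      have "(f \<circ> chart_inv c) differentiable (at y)"
        using f c y smooth_on_differentiable unfolding smooth_functions_def by blast
      then have 1: "((f \<circ> chart_inv c) has_derivative
          frechet_derivative (f \<circ> chart_inv c) (at y)) (at y)"
        using frechet_derivative_works by blast
      have 2: "frechet_derivative (f \<circ> chart_inv c) (at y) =
          frechet_derivative (\<lambda>z. fun_form A f c z []) (at y)"
        using c by (intro frechet_derivative_cong_open[OF ch(2) y]) (simp add: fun_form_def)
      have "frechet_derivative (\<lambda>z. fun_form A f c z []) (at y) v = 0" for v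
        using ext_deriv_pforms_0[OF p0, of c y "[v]"] c y d0 by simp
      then show ?thesis using 1 unfolding 2 by presburger
    qed
    then have "((f \<circ> chart_inv c) has_derivative (\<lambda>_. 0)) (at y within ball (snd c a) r)"
      if "y \<in> ball (snd c a) r" for y
      using has_derivative_at_withinI r(2) that by blast
    then have "\<exists>k. \<forall>y\<in>ball (snd c a) r. (f \<circ> chart_inv c) y = k"
      by (rule has_derivative_zero_constant[OF convex_ball])
    then obtain k where k: "\<And>y. y \<in> ball (snd c a) r \<Longrightarrow> f (chart_inv c y) = k"
      by auto
    let ?T = "fst c \<inter> snd c -` ball (snd c a) r"
    have "continuous_on (fst c) (snd c)" using ch(3) by (simp add: homeomorphism_def)
    then have "open ?T" using ch(1) continuous_open_preimage by blast
    moreover have "f x = k" if "x \<in> ?T" for x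
      using k[of "snd c x"] ch(4)[of x] that by simp
    moreover have "a \<in> ?T" using c r by simp
    ultimately show ?thesis by (intro exI[of _ ?T]) auto
  qed
  then have "f constant_on UNIV" by (intro locally_constant_imp_constant[OF conn])
  then show ?thesis by (auto simp: constant_on_def)
qed

section \<open>The kernel of \<open>\<delta>\<close> on functions\<close>

text \<open>
  A derivation kills the unit, because \<open>1 = 1 \<and> 1\<close> gives \<open>\<delta> 1 = 2 \<delta> 1\<close>.
\<close>

lemma derivation_constant_eq_0:
  fixes A :: "('m::{t2_space,second_countable_topology}, 'e::real_normed_vector) chart set"
  assumes A: "smooth_atlas A"
    and scale: "\<And>r \<alpha>. \<alpha> \<in> forms A \<Longrightarrow> \<delta> (form_scale r \<alpha>) = form_scale r (\<delta> \<alpha>)"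
    and deg: "\<And>\<alpha>. \<alpha> \<in> pforms A 0 \<Longrightarrow> \<delta> \<alpha> \<in> pforms A 1"
    and leibniz: "\<And>\<alpha> \<beta>. \<alpha> \<in> pforms A 0 \<Longrightarrow> \<beta> \<in> pforms A 0 \<Longrightarrow>
           \<delta> (wedge \<alpha> \<beta>) = wedge (\<delta> \<alpha>) \<beta> + wedge \<alpha> (\<delta> \<beta>)"
  shows "fun_form A (\<lambda>_. r) \<in> pforms A 0" "\<delta> (fun_form A (\<lambda>_. r)) = 0"
proof -
  have Ck: "Ck_on k S (\<lambda>_. r)" for k S and r :: real
    by (cases k) (auto simp: frechet_derivative_const Ck_on_zero)
  have p0: "fun_form A (\<lambda>_. r) \<in> pforms A 0" for r
    unfolding pforms_0[OF A]
    by (intro imageI) (simp add: smooth_functions_def o_def smooth_on_def Ck)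
  then show "fun_form A (\<lambda>_. r) \<in> pforms A 0" .
  let ?e = "fun_form A (\<lambda>_. 1)"
  have "\<delta> ?e = wedge (\<delta> ?e) ?e + wedge ?e (\<delta> ?e)"
    using leibniz[OF p0 p0, of 1 1] by (simp add: wedge_fun_form)
  note L = this[THEN fun_cong, THEN fun_cong, THEN fun_cong]
  have e1: "\<delta> ?e \<in> pforms A 1" using deg p0 by blast
  have "\<delta> ?e c y vs = 0" for c y vs
  proof (cases "c \<in> A \<and> y \<in> chart_image c \<and> length vs = 1")
    case True
    then obtain v where vs: "vs = [v]" by (auto simp: length_Suc_conv)
    have n: "\<delta> ?e c y [] = 0" using pforms_other_degree[OF e1] by simp
    have P: "Pow {..<length vs} = {{}, {0}}"
      by (auto simp: vs)
    have s: "shuffle_sign (length vs) S = 1" for S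
    proof -
      have "{(i, j). i < j \<and> j < length vs \<and> i \<notin> S \<and> j \<in> S} = {}" by (auto simp: vs)
      then show ?thesis unfolding shuffle_sign_def by (metis card.empty power_0)
    qed
    have w: "wedge \<beta> \<gamma> c y vs = \<beta> c y [] * \<gamma> c y [v] + \<beta> c y [v] * \<gamma> c y []"
      for \<beta> \<gamma> :: "('m, 'e) form"
    proof -
      have "wedge \<beta> \<gamma> c y vs = (\<Sum>S\<in>{{}, {0}}. \<beta> c y (nths vs S) * \<gamma> c y (nths vs (- S)))"
        unfolding wedge_def P s by simp
      also have "\<dots> = \<beta> c y (nths vs {}) * \<gamma> c y (nths vs (- {})) +
          \<beta> c y (nths vs {0}) * \<gamma> c y (nths vs (- {0}))"
        by (subst sum.insert) auto
      finally show ?thesis by (simp add: vs nths_Cons)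
    qed
    have "?e c y [] = 1" using True by (simp add: fun_form_def)
    then have "wedge (\<delta> ?e) ?e c y vs = \<delta> ?e c y vs" "wedge ?e (\<delta> ?e) c y vs = \<delta> ?e c y vs"
      unfolding w n by (simp_all add: vs)
    then show ?thesis using L[of c y vs] unfolding plus_fun_apply by linarith
  next
    case False
    then consider "c \<notin> A \<or> y \<notin> chart_image c" | "length vs \<noteq> 1" by blast
    then show ?thesis
    proof cases
      case 1
      then have "\<delta> ?e c y = 0"
        using e1 unfolding pforms_def forms_def mem_Collect_eq by meson
      then show ?thesis by simp
    next
      case 2
      then show ?thesis using pforms_other_degree[OF e1] by blast
    qed
  qed
  then have "\<delta> ?e = 0" by (simp add: fun_eq_iff)
  moreover have "fun_form A (\<lambda>_. r) = form_scale r ?e"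
    by (auto simp: fun_form_def form_scale_def fun_eq_iff)
  moreover have "form_scale r 0 = (0 :: ('m, 'e) form)"
    by (auto simp: form_scale_def fun_eq_iff)
  ultimately show "\<delta> (fun_form A (\<lambda>_. r)) = 0"
    using scale[of ?e r] p0[of 1] by (simp add: pforms_def)
qed

theorem mainTheorem4:
  fixes A :: "('m::{t2_space,second_countable_topology}, 'e::real_normed_vector) chart set"
    and \<delta> :: "('m, 'e) form \<Rightarrow> ('m, 'e) form"
  assumes "smooth_atlas A"
    and "compact (UNIV :: 'm set)"
    and "connected (UNIV :: 'm set)"
    and "\<forall>\<alpha>\<in>forms A. \<delta> \<alpha> \<in> forms A"
    and "\<forall>\<alpha>\<in>forms A. \<forall>\<beta>\<in>forms A. \<delta> (\<alpha> + \<beta>) = \<delta> \<alpha> + \<delta> \<beta>"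
    and "\<forall>r. \<forall>\<alpha>\<in>forms A. \<delta> (form_scale r \<alpha>) = form_scale r (\<delta> \<alpha>)"
    and "\<forall>p. \<forall>\<alpha>\<in>pforms A p. \<delta> \<alpha> \<in> pforms A (p + 1)"
    and "\<forall>p. \<forall>\<alpha>\<in>pforms A p. \<forall>\<beta>\<in>forms A.
           \<delta> (wedge \<alpha> \<beta>) = wedge (\<delta> \<alpha>) \<beta> + form_scale ((- 1) ^ p) (wedge \<alpha> (\<delta> \<beta>))"
    and "\<forall>\<alpha>\<in>forms A. \<delta> (\<delta> \<alpha>) = 0"
    and "{\<alpha> \<in> forms A. ext_deriv A \<alpha> = 0} \<inter> {\<alpha> \<in> forms A. \<delta> \<alpha> = 0}
           \<inter> {ext_deriv A \<alpha> + \<delta> \<beta> | \<alpha> \<beta>. \<alpha> \<in> forms A \<and> \<beta> \<in> forms A}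
         = {ext_deriv A (\<delta> \<alpha>) | \<alpha>. \<alpha> \<in> forms A}"
    and "\<forall>\<alpha>\<in>forms A. ext_deriv A (\<delta> \<alpha>) + \<delta> (ext_deriv A \<alpha>) = 0"
  shows "{\<alpha> \<in> forms A. \<delta> \<alpha> = 0} \<inter> pforms A 0 = {fun_form A (\<lambda>_. r) | r. True}"
proof -
  note A = assms(1)
  have deg: "\<And>p \<alpha>. \<alpha> \<in> pforms A p \<Longrightarrow> \<delta> \<alpha> \<in> pforms A (p + 1)"
    using assms(7) by blast
  have pf: "\<alpha> \<in> forms A" if "\<alpha> \<in> pforms A p" for \<alpha> p
    using that by (simp add: pforms_def)
  have scale1: "form_scale 1 \<omega> = \<omega>" for \<omega> :: "('m, 'e) form"
    by (simp add: form_scale_def)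
  have const: "fun_form A (\<lambda>_. r) \<in> pforms A 0" "\<delta> (fun_form A (\<lambda>_. r)) = 0" for r
  proof -
    have leibniz: "\<delta> (wedge \<alpha> \<beta>) = wedge (\<delta> \<alpha>) \<beta> + wedge \<alpha> (\<delta> \<beta>)"
      if "\<alpha> \<in> pforms A 0" "\<beta> \<in> pforms A 0" for \<alpha> \<beta>
      using assms(8)[rule_format, OF that(1) pf[OF that(2)]] by (simp add: scale1)
    have "\<delta> \<alpha> \<in> pforms A 1" if "\<alpha> \<in> pforms A 0" for \<alpha>
      using deg[OF that] by simp
    from derivation_constant_eq_0[OF A assms(6)[rule_format] this leibniz]
    show "fun_form A (\<lambda>_. r) \<in> pforms A 0" "\<delta> (fun_form A (\<lambda>_. r)) = 0" by blast+
  qed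
  have "\<exists>r. \<omega> = fun_form A (\<lambda>_. r)" if \<omega>: "\<omega> \<in> pforms A 0" "\<delta> \<omega> = 0" for \<omega>
  proof -
    obtain f where f: "f \<in> smooth_functions A" "\<omega> = fun_form A f"
      using \<omega>(1) pforms_0[OF A] by blast
    let ?d\<omega> = "ext_deriv A \<omega>"
    have d\<omega>: "?d\<omega> \<in> forms A" using ext_deriv_pforms_0_in_forms[OF A \<omega>(1)] .
    have z: "(0 :: ('m, 'e) form) \<in> forms A" using zero_in_forms[OF d\<omega>] .
    have \<delta>0: "\<delta> 0 = 0"
    proof -
      have "\<delta> (0 + 0) = \<delta> 0 + \<delta> 0" using assms(5) z by blast
      then show ?thesis by simp
    qed
    have d0: "ext_deriv A (0 :: ('m, 'e) form) = 0"
      by (auto simp: ext_deriv_def fun_eq_iff frechet_derivative_const)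
    have "\<delta> ?d\<omega> = 0"
      using assms(11) pf[OF \<omega>(1)] \<omega>(2) d0 by (metis add_0)
    moreover have "ext_deriv A ?d\<omega> = 0"
      using ext_deriv_ext_deriv_pforms_0[OF A \<omega>(1)] .
    moreover have "?d\<omega> = ext_deriv A \<omega> + \<delta> 0" using \<delta>0 by simp
    ultimately have "?d\<omega> \<in> {ext_deriv A (\<delta> \<alpha>) | \<alpha>. \<alpha> \<in> forms A}"
      unfolding assms(10)[symmetric] using d\<omega> pf[OF \<omega>(1)] z by blast
    then obtain \<alpha> where \<alpha>: "\<alpha> \<in> forms A" "?d\<omega> = ext_deriv A (\<delta> \<alpha>)" by blast
    \<comment> \<open>On a single vector, \<open>d \<delta> \<alpha>\<close> differentiates the part of degree 0 of \<open>\<delta> \<alpha>\<close>.\<close>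
    have no0: "\<delta> \<alpha> c y [] = 0" for c y
      using degree_raising_no_degree_0[OF A assms(5)[rule_format] deg \<alpha>(1)] by blast
    have "?d\<omega> c y vs = 0" for c y vs
    proof (cases "length vs = 1")
      case True
      then show ?thesis
        unfolding \<alpha>(2) by (simp add: ext_deriv_def no0 frechet_derivative_const)
    next
      case False
      then show ?thesis using ext_deriv_pforms_0[OF \<omega>(1)] by simp
    qed
    then have "ext_deriv A (fun_form A f) = 0" using f(2) by (simp add: fun_eq_iff)
    then show ?thesis
      using ext_deriv_fun_form_eq_0_imp_constant[OF A assms(3) f(1)] f(2) by blast
  qed
  then show ?thesis using const pf by blast
qed

end
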